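(* Let $\mathsf{SG}$ be the doubly-infinite Sierpiński gasket graph with origin $o=(0,0)$, and let $(R_t)_{t\ge 0}$ be the uniform rotor walk on $\mathsf{SG}$ with $R_0=o$, where the neighbours of each vertex are ordered anticlockwise. Then $(R_t)_{t\ge 0}$ is recurrent, i.e. almost surely it visits each vertex of $\mathsf{SG}$ infinitely many times.
   Context: **The graph $\mathsf{SG}$.** In $\mathbb{R}^2$ let $V_0=\{(0,0),(1,0),(1/2,\sqrt3/2)\}$ and let $E_0$ be the set of the three (undirected) edges joining pairs of distinct points of $V_0$. For $n\ge 0$ define recursively $$V_{n+1}=V_n\cup\big((2^n,0)+V_n\big)\cup\big((2^{n-1},2^{n-1}\sqrt3)+V_n\big),\qquad E_{n+1}=E_n\cup\big((2^n,0)+E_n\big)\cup\big((2^{n-1},2^{n-1}\sqrt3)+E_n\big),$$ where translations act on edges through their endpoints. Let $V_\infty=\bigcup_n V_n$, $E_\infty=\bigcup_n E_n$, and let $V'_\infty,E'_\infty$ be their reflections under $(x,y)\mapsto(-x,y)$. The doubly-infinite Sierpiński gasket graph $\mathsf{SG}$ has vertex set $V_\infty\cup V'_\infty$ and edge set $E_\infty\cup E'_\infty$. Every vertex has degree $4$. "$x\in\mathsf{SG}$" means that $x$ is a vertex of $\mathsf{SG}$. **Rotor walk.** For each vertex $x$ fix a listing $\mathsf{cyc}(x)=\{x^1,x^2,x^3,x^4\}$ of its neighbours in anticlockwise cyclic order (with respect to the planar drawing above). A rotor configuration is a function $\rho:\mathsf{SG}\to\{1,2,3,4\}$, where $\rho(x)=i$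 means that the rotor at $x$ points to $x^i$. Given an initial rotor configuration $\rho_0=\rho$ and $R_0=o$, the rotor walk is defined recursively: at time $t$, first increment the rotor at the current position, i.e. $\rho_{t+1}(R_t)=\rho_t(R_t)+1$ modulo $4$ (with values in $\{1,2,3,4\}$) and $\rho_{t+1}(x)=\rho_t(x)$ for $x\ne R_t$; then move in the new direction, $R_{t+1}=R_t^{\rho_{t+1}(R_t)}$. **Uniform rotor walk.** The rotor walk in which the initial configuration $(\rho(x))_{x\in\mathsf{SG}}$ is a family of i.i.d. random variables uniformly distributed on $\{1,2,3,4\}$. *)

theory Defs
  imports "HOL-Probability.Probability"
begin

text \<open>
  The plane is modelled by the type of complex numbers, so that angles can be measured by
  \<^const>\<open>Arg2pi\<close>, the argument with values in the interval from 0 (included) to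
  2 pi (excluded).  Undirected edges are two-element sets of vertices.
\<close>

definition SG_shifts :: "nat \<Rightarrow> complex set" where
  "SG_shifts n = {Complex 0 0, Complex (2 ^ n) 0, Complex (2 ^ n / 2) (2 ^ n / 2 * sqrt 3)}"

primrec SG_V :: "nat \<Rightarrow> complex set" where
  "SG_V 0 = {Complex 0 0, Complex 1 0, Complex (1 / 2) (sqrt 3 / 2)}"
| "SG_V (Suc n) = (\<Union>s\<in>SG_shifts n. (\<lambda>v. s + v) ` SG_V n)"

primrec SG_E :: "nat \<Rightarrow> complex set set" where
  "SG_E 0 = {{p, q} | p q. p \<in> SG_V 0 \<and> q \<in> SG_V 0 \<and> p \<noteq> q}"
| "SG_E (Suc n) = (\<Union>s\<in>SG_shifts n. (\<lambda>e. (\<lambda>v. s + v) ` e) ` SG_E n)"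

definition SG_reflect :: "complex \<Rightarrow> complex" where
  "SG_reflect z = Complex (- Re z) (Im z)"

definition SG_vertices :: "complex set" where
  "SG_vertices = (\<Union>n. SG_V n) \<union> SG_reflect ` (\<Union>n. SG_V n)"

definition SG_edges :: "complex set set" where
  "SG_edges = (\<Union>n. SG_E n) \<union> (\<lambda>e. SG_reflect ` e) ` (\<Union>n. SG_E n)"

definition SG_neighbours :: "complex \<Rightarrow> complex set" where
  "SG_neighbours x = {y. {x, y} \<in> SG_edges}"

text \<open>
  In an anticlockwise listing \<open>cyc x 1, \<dots>, cyc x 4\<close> of the neighbours of \<open>x\<close>, the choice of the
  first neighbour is free; the others follow in order of the angle measured anticlockwise from
  the direction of the first one.
\<close>

definition anticlockwise_listing :: "(complex \<Rightarrow> nat \<Rightarrow> complex) \<Rightarrow> bool" where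
  "anticlockwise_listing cyc \<longleftrightarrow>
     (\<forall>x\<in>SG_vertices.
        bij_betw (cyc x) {1..4} (SG_neighbours x) \<and>
        strict_mono_on {1..4} (\<lambda>i. Arg2pi ((cyc x i - x) / (cyc x 1 - x))))"

text \<open>
  The state of the walk is the current position together with the current rotor configuration.
  On the values 1, 2, 3, 4 the map \<open>i \<mapsto> i mod 4 + 1\<close> is the cyclic successor.
\<close>

definition rotor_step ::
    "(complex \<Rightarrow> nat \<Rightarrow> complex) \<Rightarrow> complex \<times> (complex \<Rightarrow> nat) \<Rightarrow> complex \<times> (complex \<Rightarrow> nat)" where
  "rotor_step cyc = (\<lambda>(x, \<rho>). let \<rho>' = \<rho>(x := \<rho> x mod 4 + 1) in (cyc x (\<rho>' x), \<rho>'))"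

definition rotor_walk ::
    "(complex \<Rightarrow> nat \<Rightarrow> complex) \<Rightarrow> (complex \<Rightarrow> nat) \<Rightarrow> complex \<Rightarrow> nat \<Rightarrow> complex" where
  "rotor_walk cyc \<rho> x0 t = fst ((rotor_step cyc ^^ t) (x0, \<rho>))"

text \<open>
  The target \<open>count_space {1..4}\<close> forces rotors to take values in \<open>{1..4}\<close> at every
  point of the probability space, not only almost surely.
\<close>

definition uniform_rotors :: "'w measure \<Rightarrow> (complex \<Rightarrow> 'w \<Rightarrow> nat) \<Rightarrow> bool" where
  "uniform_rotors M \<rho> \<longleftrightarrow>
     prob_space.indep_vars M (\<lambda>_. count_space {1..4}) \<rho> SG_vertices \<and>
     (\<forall>x\<in>SG_vertices. distr M (count_space {1..4}) (\<rho> x) = uniform_count_measure {1..4})"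

end

theory Submission
  imports Defs
begin

text \<open>
  The gasket is cut by four vertices at every scale: the block of all vertices of level
  (\<open>gasket_level\<close>) at most \<open>2 ^ n\<close> meets the rest of the graph only in its four outer corners,
  each of which has two neighbours inside the block and two outside.  In the anticlockwise order the
  two inner neighbours of a corner are adjacent.  Hence with probability \<open>1/4\<close> the rotor of a corner
  is set so that the first two departures from it go back into the block.  For all four corners of a
  block this has probability \<open>1/256\<close>; the corners of different blocks are different vertices, so
  almost surely it happens for infinitely many blocks (\<open>uniform_rotors_agree_infinitely_often\<close>).

  Such a block cannot be left before the walk returns to its starting point.  The reason is that a
  rotor walk traverses no directed edge twice before its first return (\<open>no_repeated_traversal\<close>),
  while a step out of the block would be preceded by three arrivals at a corner through only two
  edges (\<open>barrier_confines\<close>).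

  If the walk visited the origin only finitely often, one could restart it at the last visit and
  take a block as above whose corners have not been visited yet.  The walk would then stay in this
  finite block for ever and visit some vertex infinitely often.  But the rotor of such a vertex
  keeps pointing to each of its neighbours, so all vertices of the connected graph, the origin
  included, would be visited infinitely often (\<open>recurrent_if_barriers\<close>).
\<close>

section \<open>Rotor walks and barriers\<close>

lemma pigeonhole_ordered:
  fixes S :: "'a :: linorder set"
  assumes "finite T" "card T < card S" "f ` S \<subseteq> T"
  obtains a b where "a \<in> S" "b \<in> S" "a < b" "f a = f b"
proof -
  have "\<not> inj_on f S"
    using pigeonhole[of f S] card_mono[OF assms(1,3)] assms(2) by linarith
  then obtain a b where ab: "a \<in> S" "b \<in> S" "a \<noteq> b" "f a = f b"
    by (auto simp: inj_on_def)
  show ?thesis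
  proof (cases "a < b")
    case True
    then show ?thesis using that[of a b] ab by simp
  next
    case False
    then show ?thesis using that[of b a] ab by simp
  qed
qed

definition rotor_conf ::
    "(complex \<Rightarrow> nat \<Rightarrow> complex) \<Rightarrow> (complex \<Rightarrow> nat) \<Rightarrow> complex \<Rightarrow> nat \<Rightarrow> complex \<Rightarrow> nat" where
  "rotor_conf cyc \<rho> x0 t = snd ((rotor_step cyc ^^ t) (x0, \<rho>))"

text \<open>
  The combinatorics of the walk takes place in any graph of degree 4 with some cyclic listing of the
  neighbours of each vertex; the geometry of the gasket enters later, when barriers are exhibited.
\<close>

locale rotor_graph =
  fixes V :: "complex set"
    and nbr :: "complex \<Rightarrow> complex set"
    and cyc :: "complex \<Rightarrow> nat \<Rightarrow> complex"
  assumes listing: "\<And>x. x \<in> V \<Longrightarrow> bij_betw (cyc x) {1..4} (nbr x)"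
    and nbr_sym: "\<And>x y. y \<in> nbr x \<Longrightarrow> x \<in> nbr y"
    and nbr_in_V: "\<And>x. x \<in> V \<Longrightarrow> nbr x \<subseteq> V"
begin

abbreviation "walk \<equiv> rotor_walk cyc"
abbreviation "conf \<equiv> rotor_conf cyc"

definition visits :: "(complex \<Rightarrow> nat) \<Rightarrow> complex \<Rightarrow> nat \<Rightarrow> complex \<Rightarrow> nat" where
  "visits \<rho> x0 t v = card {s. s < t \<and> walk \<rho> x0 s = v}"

lemma finite_nbr: "x \<in> V \<Longrightarrow> finite (nbr x)"
  and card_nbr: "x \<in> V \<Longrightarrow> card (nbr x) = 4"
  using listing[of x] bij_betw_finite[of "cyc x" "{1..4}" "nbr x"]
    bij_betw_same_card[of "cyc x" "{1..4}" "nbr x"] by auto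

lemma cyc_in_nbr: "x \<in> V \<Longrightarrow> cyc x (k mod 4 + 1) \<in> nbr x"
  using bij_betwE[OF listing[of x]] by simp

lemma nbr_is_cyc:
  assumes "x \<in> V" "y \<in> nbr x"
  obtains r where "r < 4" "y = cyc x (r + 1)"
proof -
  have "y \<in> cyc x ` {1..4}" using listing[OF assms(1)] assms(2) by (simp add: bij_betw_def)
  then obtain j where "j \<in> {1..4}" "y = cyc x j" by blast
  then show ?thesis using that[of "j - 1"] by auto
qed

lemma cyc_eq_iff:
  assumes "x \<in> V"
  shows "cyc x (k mod 4 + 1) = cyc x (l mod 4 + 1) \<longleftrightarrow> k mod 4 = l mod 4"
  using inj_on_eq_iff[of "cyc x" "{1..4}" "k mod 4 + 1" "l mod 4 + 1"] listing[OF assms]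
  by (simp add: bij_betw_def)

lemma walk_0 [simp]: "walk \<rho> x0 0 = x0"
  by (simp add: rotor_walk_def)

lemma conf_0 [simp]: "conf \<rho> x0 0 = \<rho>"
  by (simp add: rotor_conf_def)

lemma state_eq: "(rotor_step cyc ^^ t) (x0, \<rho>) = (walk \<rho> x0 t, conf \<rho> x0 t)"
  by (simp add: rotor_walk_def rotor_conf_def)

lemma state_Suc:
  "(walk \<rho> x0 (Suc t), conf \<rho> x0 (Suc t)) = rotor_step cyc (walk \<rho> x0 t, conf \<rho> x0 t)"
  by (simp flip: state_eq)

lemma conf_Suc:
  "conf \<rho> x0 (Suc t) =
     (conf \<rho> x0 t)(walk \<rho> x0 t := conf \<rho> x0 t (walk \<rho> x0 t) mod 4 + 1)"
  using state_Suc[of \<rho> x0 t] by (simp add: rotor_step_def Let_def)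

lemma walk_Suc_conf:
  "walk \<rho> x0 (Suc t) = cyc (walk \<rho> x0 t) (conf \<rho> x0 t (walk \<rho> x0 t) mod 4 + 1)"
  using state_Suc[of \<rho> x0 t] by (simp add: rotor_step_def Let_def)

lemma walk_add: "walk \<rho> x0 (s + t) = walk (conf \<rho> x0 s) (walk \<rho> x0 s) t"
proof -
  have "(rotor_step cyc ^^ (s + t)) (x0, \<rho>) = (rotor_step cyc ^^ t) ((rotor_step cyc ^^ s) (x0, \<rho>))"
    by (simp add: add.commute[of s] funpow_add)
  then show ?thesis by (simp add: state_eq)
qed

lemma visits_0 [simp]: "visits \<rho> x0 0 v = 0"
  by (simp add: visits_def)

lemma visits_Suc:
  "visits \<rho> x0 (Suc t) v = visits \<rho> x0 t v + (if walk \<rho> x0 t = v then 1 else 0)"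
proof -
  have "{s. s < Suc t \<and> walk \<rho> x0 s = v} =
      (if walk \<rho> x0 t = v then insert t {s. s < t \<and> walk \<rho> x0 s = v}
       else {s. s < t \<and> walk \<rho> x0 s = v})"
    by (auto simp: less_Suc_eq)
  then show ?thesis by (simp add: visits_def)
qed

lemma visits_mono: "s \<le> t \<Longrightarrow> visits \<rho> x0 s v \<le> visits \<rho> x0 t v"
  unfolding visits_def by (intro card_mono) auto

text \<open>
  Indices of rotors are kept modulo 4, so that the statement holds for every initial value,
  including those outside \<open>{1..4}\<close>: after its first turn a rotor has a value in that range anyway.
\<close>

lemma conf_mod: "conf \<rho> x0 t v mod 4 = (\<rho> v + visits \<rho> x0 t v) mod 4"
proof (induction t)
  case (Suc t)
  then show ?case by (simp add: conf_Suc visits_Suc mod_Suc_eq) (metis mod_Suc_eq)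
qed simp

lemma conf_unvisited: "(\<And>s. s < t \<Longrightarrow> walk \<rho> x0 s \<noteq> v) \<Longrightarrow> conf \<rho> x0 t v = \<rho> v"
  by (induction t) (auto simp: conf_Suc)

text \<open>
  Expressed through the initial rotors: the \<open>k\<close>-th departure from \<open>v\<close>, counting from 0, uses the
  neighbour number \<open>(\<rho> v + k) mod 4 + 1\<close>.
\<close>

lemma walk_Suc:
  "walk \<rho> x0 (Suc t) =
     cyc (walk \<rho> x0 t) ((\<rho> (walk \<rho> x0 t) + visits \<rho> x0 t (walk \<rho> x0 t)) mod 4 + 1)"
  by (simp only: walk_Suc_conf conf_mod)

lemma walk_in_V: "x0 \<in> V \<Longrightarrow> walk \<rho> x0 t \<in> V"
proof (induction t)
  case (Suc t)
  then show ?case using cyc_in_nbr nbr_in_V unfolding walk_Suc by blast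
qed simp

lemma walk_Suc_nbr: "x0 \<in> V \<Longrightarrow> walk \<rho> x0 (Suc t) \<in> nbr (walk \<rho> x0 t)"
  unfolding walk_Suc using cyc_in_nbr walk_in_V by blast

lemma walk_pred_nbr: "x0 \<in> V \<Longrightarrow> s > 0 \<Longrightarrow> walk \<rho> x0 (s - 1) \<in> nbr (walk \<rho> x0 s)"
  using walk_Suc_nbr[of x0 \<rho> "s - 1"] nbr_sym by simp

text \<open>
  The visit at time \<open>t\<close> itself is the one extra visit.  Each visit is an arrival, unless it takes place
  at time 0, and these arrivals are what the pigeonhole arguments below count.
\<close>

lemma card_visits_upto:
  assumes "walk \<rho> x0 t = v"
  shows "card {s. s \<le> t \<and> walk \<rho> x0 s = v} = visits \<rho> x0 t v + 1"
  using visits_Suc[of \<rho> x0 t v] assms by (simp add: visits_def less_Suc_eq_le)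

text \<open>
  Consider the earliest second traversal of a directed edge, and let \<open>v\<close> be its tail.  The rotor at
  \<open>v\<close> has made a full turn in between, so \<open>v\<close> has been visited at least five times.  Since \<open>v\<close> is
  not the starting point, the walk has arrived five times through the four edges into \<open>v\<close>, so one of
  these edges was already traversed twice.
\<close>

lemma no_repeated_traversal:
  assumes o: "x0 \<in> V" and no_return: "\<And>s. 0 < s \<Longrightarrow> s \<le> t \<Longrightarrow> walk \<rho> x0 s \<noteq> x0"
    and "i < j" "j \<le> t" "walk \<rho> x0 i = walk \<rho> x0 j"
  shows "walk \<rho> x0 (Suc i) \<noteq> walk \<rho> x0 (Suc j)"
  using \<open>i < j\<close> \<open>j \<le> t\<close> \<open>walk \<rho> x0 i = walk \<rho> x0 j\<close>
proof (induction j arbitrary: i rule: less_induct)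
  case (less j)
  define v where "v = walk \<rho> x0 j"
  have vV: "v \<in> V" using o walk_in_V v_def by simp
  have v_o: "v \<noteq> x0" using no_return[of j] less.prems v_def by simp
  show ?case
  proof
    assume eq: "walk \<rho> x0 (Suc i) = walk \<rho> x0 (Suc j)"
    have "(\<rho> v + visits \<rho> x0 i v) mod 4 = (\<rho> v + visits \<rho> x0 j v) mod 4"
      using eq less.prems cyc_eq_iff[OF vV] by (simp add: walk_Suc v_def)
    then have "visits \<rho> x0 i v mod 4 = visits \<rho> x0 j v mod 4"
      by (simp add: nat_mod_eq_iff)
    moreover have "visits \<rho> x0 i v < visits \<rho> x0 j v"
      using visits_mono[of "Suc i" j \<rho> x0 v] visits_Suc[of \<rho> x0 i v] less.prems v_def by simp
    ultimately have "visits \<rho> x0 j v \<ge> 4" by presburger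
    define S where "S = {s. s \<le> j \<and> walk \<rho> x0 s = v}"
    have "card S \<ge> 5"
      using card_visits_upto[of \<rho> x0 j v] \<open>visits \<rho> x0 j v \<ge> 4\<close> by (simp add: S_def v_def)
    have pos: "s > 0" if "s \<in> S" for s
      using that v_o by (cases s) (auto simp: S_def)
    have "(\<lambda>s. walk \<rho> x0 (s - 1)) ` S \<subseteq> nbr v"
      using walk_pred_nbr[OF o pos] by (auto simp: S_def)
    moreover have "card (nbr v) < card S"
      using card_nbr[OF vV] \<open>card S \<ge> 5\<close> by simp
    ultimately obtain a b where
        ab: "a \<in> S" "b \<in> S" "a < b" "walk \<rho> x0 (a - 1) = walk \<rho> x0 (b - 1)"
      using pigeonhole_ordered[of "nbr v" S "\<lambda>s. walk \<rho> x0 (s - 1)"] finite_nbr[OF vV] by blast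
    have "a > 0" using pos ab by blast
    then have "walk \<rho> x0 (Suc (a - 1)) \<noteq> walk \<rho> x0 (Suc (b - 1))"
      using ab less.prems by (intro less.IH) (auto simp: S_def)
    then show False using ab \<open>a > 0\<close> by (simp add: S_def)
  qed
qed

definition exits :: "complex set \<Rightarrow> complex set" where
  "exits B = {x \<in> B. \<not> nbr x \<subseteq> B}"

text \<open>
  At an exit vertex of a barrier the next two departures stay inside \<open>B\<close>, while at most two edges lead
  to it from \<open>B\<close>.  The walk would need a third arrival in order to leave.
\<close>

definition barrier :: "(complex \<Rightarrow> nat) \<Rightarrow> complex set \<Rightarrow> bool" where
  "barrier \<rho> B \<longleftrightarrow> finite B \<and> (\<forall>c\<in>exits B. card (nbr c \<inter> B) \<le> 2 \<and>
     cyc c (\<rho> c mod 4 + 1) \<in> B \<and> cyc c ((\<rho> c + 1) mod 4 + 1) \<in> B)"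

text \<open>
  The first step out of \<open>B\<close> would be at least the third departure from an exit vertex \<open>c\<close>.  The three
  arrivals at \<open>c\<close> come from neighbours inside \<open>B\<close>, of which there are at most two, so one edge has been
  traversed twice, although the walk has not come back to its starting point.
\<close>

lemma barrier_confines:
  assumes o: "x0 \<in> V" "x0 \<in> B" "x0 \<notin> exits B"
    and barrier: "barrier \<rho> B"
    and no_return: "\<And>s. 0 < s \<Longrightarrow> walk \<rho> x0 s \<noteq> x0"
  shows "walk \<rho> x0 t \<in> B"
proof (induction t rule: less_induct)
  case (less t)
  show ?case
  proof (cases t)
    case 0
    then show ?thesis using o by simp
  next
    case (Suc u)
    define c where "c = walk \<rho> x0 u"
    have cV: "c \<in> V" using o walk_in_V c_def by simp
    have cB: "c \<in> B" using less Suc c_def by simp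
    show ?thesis
    proof (rule ccontr)
      assume out: "walk \<rho> x0 t \<notin> B"
      have step: "walk \<rho> x0 t = cyc c ((\<rho> c + visits \<rho> x0 u c) mod 4 + 1)"
        using walk_Suc[of \<rho> x0 u] by (simp add: Suc c_def)
      have "c \<in> exits B"
        using out cB cyc_in_nbr[OF cV] step by (auto simp: exits_def)
      then have c: "card (nbr c \<inter> B) \<le> 2" "cyc c (\<rho> c mod 4 + 1) \<in> B"
          "cyc c ((\<rho> c + 1) mod 4 + 1) \<in> B" "c \<noteq> x0"
        using barrier o by (auto simp: barrier_def)
      have "visits \<rho> x0 u c \<noteq> 0" "visits \<rho> x0 u c \<noteq> 1"
        by (intro notI; use c(2,3) out step in simp)+
      define S where "S = {s. s \<le> u \<and> walk \<rho> x0 s = c}"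
      \<comment> \<open>two departures into \<open>B\<close>, and the present visit\<close>
      have "card S \<ge> 3"
        using card_visits_upto[of \<rho> x0 u c] \<open>visits \<rho> x0 u c \<noteq> 0\<close> \<open>visits \<rho> x0 u c \<noteq> 1\<close>
        by (simp add: S_def c_def)
      have pos: "s > 0" if "s \<in> S" for s
        using that c by (cases s) (auto simp: S_def)
      have "(\<lambda>s. walk \<rho> x0 (s - 1)) ` S \<subseteq> nbr c \<inter> B"
        using walk_pred_nbr[OF o(1) pos] less Suc by (auto simp: S_def)
      moreover have "finite (nbr c \<inter> B)" "card (nbr c \<inter> B) < card S"
        using finite_nbr[OF cV] c(1) \<open>card S \<ge> 3\<close> by auto
      ultimately obtain a b where
          ab: "a \<in> S" "b \<in> S" "a < b" "walk \<rho> x0 (a - 1) = walk \<rho> x0 (b - 1)"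
        using pigeonhole_ordered[of "nbr c \<inter> B" S "\<lambda>s. walk \<rho> x0 (s - 1)"] by blast
      have "a > 0" using pos ab by blast
      then have "walk \<rho> x0 (Suc (a - 1)) \<noteq> walk \<rho> x0 (Suc (b - 1))"
        using ab by (intro no_repeated_traversal[of x0 u]) (auto simp: S_def o no_return)
      then show False using ab \<open>a > 0\<close> by (simp add: S_def)
    qed
  qed
qed

text \<open>
  The rotor at a vertex that is visited infinitely often points to each of its neighbours again and
  again.
\<close>

lemma visited_infinitely_nbr:
  assumes o: "x0 \<in> V" and inf: "infinite {t. walk \<rho> x0 t = v}" and w: "w \<in> nbr v"
  shows "infinite {t. walk \<rho> x0 t = w}"
proof -
  define S where "S = {t. walk \<rho> x0 t = v}"
  have S: "infinite S" using inf S_def by simp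
  have "v \<in> V" using S walk_in_V[OF o] not_finite_existsD[of "\<lambda>t. walk \<rho> x0 t = v"]
    by (auto simp: S_def)
  obtain r where r: "r < 4" "w = cyc v (r + 1)" using nbr_is_cyc[OF \<open>v \<in> V\<close> w] .
  have "visits \<rho> x0 (enumerate S k) v = k" for k
  proof -
    have "{s. s < enumerate S k \<and> walk \<rho> x0 s = v} = enumerate S ` {..<k}"
    proof (intro equalityI subsetI)
      fix s assume s: "s \<in> {s. s < enumerate S k \<and> walk \<rho> x0 s = v}"
      then obtain l where "s = enumerate S l"
        using enumerate_Ex[OF S, of s] by (auto simp: S_def)
      then show "s \<in> enumerate S ` {..<k}" using s S by simp
    next
      fix s assume "s \<in> enumerate S ` {..<k}"
      then obtain l where l: "l < k" "s = enumerate S l" by blast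
      moreover have "s \<in> S" using l enumerate_in_set[OF S] by simp
      ultimately show "s \<in> {s. s < enumerate S k \<and> walk \<rho> x0 s = v}"
        using S by (simp add: S_def)
    qed
    then show ?thesis
      using inj_enumerate[OF S] by (simp add: visits_def card_image inj_on_subset)
  qed
  then have step: "walk \<rho> x0 (Suc (enumerate S k)) = cyc v ((\<rho> v + k) mod 4 + 1)" for k
    using enumerate_in_set[OF S, of k] by (simp add: walk_Suc S_def)
  have "\<exists>t\<ge>m. walk \<rho> x0 t = w" for m
  proof -
    \<comment> \<open>\<open>k\<close> is large and solves \<open>\<rho> v + k \<equiv> r (mod 4)\<close>; the multiple of \<open>\<rho> v\<close> keeps the subtraction
       from being truncated\<close>
    define k where "k = 4 * (m + \<rho> v) + r - \<rho> v"
    have "\<rho> v + k = r + 4 * (m + \<rho> v)" and "m \<le> k" by (auto simp: k_def)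
    then have "(\<rho> v + k) mod 4 = r" using \<open>r < 4\<close> by simp
    moreover have "m \<le> Suc (enumerate S k)"
      using le_enumerate[OF S, of k] \<open>m \<le> k\<close> by linarith
    ultimately show ?thesis using step[of k] r by metis
  qed
  then show ?thesis by (auto simp: infinite_nat_iff_unbounded_le)
qed

definition linked :: "(complex \<times> complex) set" where
  "linked = {(x, y). y \<in> nbr x}\<^sup>*"

lemma visited_infinitely_linked:
  assumes "x0 \<in> V" and "infinite {t. walk \<rho> x0 t = v}" and "(v, w) \<in> linked"
  shows "infinite {t. walk \<rho> x0 t = w}"
  using assms(3) unfolding linked_def
  by (induction rule: rtrancl_induct) (use assms visited_infinitely_nbr in auto)

lemma linked_sym: "(v, w) \<in> linked \<Longrightarrow> (w, v) \<in> linked"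
  unfolding linked_def
  by (metis (mono_tags, lifting) case_prod_conv mem_Collect_eq nbr_sym sym_rtrancl symD symI)

text \<open>
  Suppose that the walk visits \<open>x0\<close> for the last time at time \<open>T\<close>.  Up to then it has seen only
  finitely many vertices, so there is a barrier whose exit vertices still carry their initial rotors
  at time \<open>T\<close>.  The walk restarted at time \<open>T\<close> never returns to \<open>x0\<close> and is therefore confined to a
  finite set.  Some vertex is then visited infinitely often, and by connectedness so is \<open>x0\<close>.
\<close>

theorem recurrent_if_barriers:
  assumes o: "x0 \<in> V" and connected: "\<And>v. v \<in> V \<Longrightarrow> (x0, v) \<in> linked"
    and barriers: "\<And>F. finite F \<Longrightarrow> \<exists>B. barrier \<rho> B \<and> x0 \<in> B \<and> exits B \<inter> F = {}"
    and v: "v \<in> V"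
  shows "infinite {t. walk \<rho> x0 t = v}"
proof -
  have "infinite {t. walk \<rho> x0 t = x0}"
  proof
    assume fin: "finite {t. walk \<rho> x0 t = x0}"
    define T where "T = Max {t. walk \<rho> x0 t = x0}"
    have ne: "{t. walk \<rho> x0 t = x0} \<noteq> {}" using walk_0 by blast
    have T: "walk \<rho> x0 T = x0" using Max_in[OF fin ne] T_def by simp
    have late: "walk \<rho> x0 t \<noteq> x0" if "t > T" for t
      using Max_ge[OF fin, of t] that T_def by auto
    obtain B where B: "barrier \<rho> B" "x0 \<in> B" "exits B \<inter> walk \<rho> x0 ` {..T} = {}"
      using barriers[of "walk \<rho> x0 ` {..T}"] by auto
    define \<rho>' where "\<rho>' = conf \<rho> x0 T"
    have same: "\<rho>' c = \<rho> c" if "c \<in> exits B" for c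
      using B(3) that unfolding \<rho>'_def by (intro conf_unvisited) auto
    have shift: "walk \<rho> x0 (T + t) = walk \<rho>' x0 t" for t
      by (simp add: walk_add T \<rho>'_def)
    have "barrier \<rho>' B" using B(1) same by (simp add: barrier_def)
    \<comment> \<open>\<open>x0\<close> itself is among the visited vertices, so it is not an exit vertex\<close>
    moreover have "x0 \<notin> exits B" using B(3) T by (metis IntI atMost_iff empty_iff image_eqI order_refl)
    moreover have "walk \<rho>' x0 s \<noteq> x0" if "s > 0" for s
      using late[of "T + s"] that by (simp add: shift)
    ultimately have inB: "walk \<rho>' x0 t \<in> B" for t
      using barrier_confines o B(2) by blast
    have "finite (range (walk \<rho>' x0))"
      using inB B(1) by (auto simp: barrier_def intro: finite_subset)
    then obtain k where "infinite {t. walk \<rho>' x0 t = walk \<rho>' x0 k}"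
      using pigeonhole_infinite[of UNIV "walk \<rho>' x0"] by auto
    moreover have "(walk \<rho>' x0 k, x0) \<in> linked"
      using linked_sym connected walk_in_V[OF o] by blast
    ultimately have "infinite {t. walk \<rho>' x0 t = x0}"
      using visited_infinitely_linked[OF o] by blast
    moreover have "{t. walk \<rho>' x0 t = x0} \<subseteq> {0}"
    proof safe
      fix t assume "walk \<rho>' x0 t = x0"
      then show "t = 0" using late[of "T + t"] shift[of t] by (cases t) auto
    qed
    ultimately show False using finite_subset by blast
  qed
  then show ?thesis using visited_infinitely_linked o connected v by blast
qed

end

section \<open>Independent events that occur infinitely often\<close>

lemma (in prob_space) indep_events_INT_disjoint:
  assumes indep: "indep_events A I"
    and K: "\<And>j. j \<in> J \<Longrightarrow> K j \<subseteq> I" "\<And>j. j \<in> J \<Longrightarrow> finite (K j)" "\<And>j. j \<in> J \<Longrightarrow> K j \<noteq> {}"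
      "disjoint_family_on K J"
  shows "indep_events (\<lambda>j. \<Inter>i\<in>K j. A i) J"
proof (rule indep_eventsI)
  have prob_INT: "prob (\<Inter>i\<in>L. A i) = (\<Prod>i\<in>L. prob (A i))"
    if "L \<subseteq> I" "finite L" "L \<noteq> {}" for L
    using indep that by (auto simp: indep_events_def)
  have ev: "A i \<in> events" if "i \<in> I" for i
    using indep that by (auto simp: indep_events_def)
  show "(\<Inter>i\<in>K j. A i) \<in> events" if "j \<in> J" for j
    using that K(1-3)[OF that] ev by (intro sets.finite_INT) auto
  fix L assume L: "L \<subseteq> J" "finite L" "L \<noteq> {}"
  have "(\<Inter>j\<in>L. \<Inter>i\<in>K j. A i) = (\<Inter>i\<in>(\<Union>j\<in>L. K j). A i)"
    by auto
  also have "prob \<dots> = (\<Prod>i\<in>(\<Union>j\<in>L. K j). prob (A i))"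
  proof (rule prob_INT)
    show "(\<Union>j\<in>L. K j) \<noteq> {}" using L K(3) by fast
  qed (use L K in auto)
  also have "\<dots> = (\<Prod>j\<in>L. \<Prod>i\<in>K j. prob (A i))"
    using L K unfolding disjoint_family_on_def by (intro prod.UNION_disjoint) (auto simp: subset_eq)
  also have "\<dots> = (\<Prod>j\<in>L. prob (\<Inter>i\<in>K j. A i))"
    using L K by (intro prod.cong refl prob_INT[symmetric]) auto
  finally show "prob (\<Inter>j\<in>L. \<Inter>i\<in>K j. A i) = (\<Prod>j\<in>L. prob (\<Inter>i\<in>K j. A i))" .
qed

text \<open>
  This is the case of the second Borel--Cantelli lemma in which the probabilities are bounded away
  from 0.  The probability of the limit superior is at least \<open>\<epsilon>\<close>, and by the zero-one law it is 1.
\<close>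

lemma (in prob_space) AE_infinitely_often_indep:
  assumes indep: "indep_events F (UNIV :: nat set)"
    and lower: "\<And>n. \<epsilon> \<le> prob (F n)" and "0 < \<epsilon>"
  shows "AE \<omega> in M. infinite {n. \<omega> \<in> F n}"
proof -
  have F: "F n \<in> events" for n using indep by (auto simp: indep_events_def)
  define U where "U n = (\<Union>m\<in>{n..}. F m)" for n
  have U: "U n \<in> events" for n unfolding U_def using F by (intro sets.countable_UN'') auto
  have "(\<lambda>n. prob (U n)) \<longlonglongrightarrow> prob (\<Inter>n. U n)"
  proof (rule finite_Lim_measure_decseq)
    show "range U \<subseteq> events" using U by blast
    show "decseq U" unfolding decseq_def U_def by (meson UN_mono atLeast_subset_iff order_refl)
  qed
  moreover have "\<epsilon> \<le> prob (U n)" for n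
  proof -
    have "\<epsilon> \<le> prob (F n)" by (rule lower)
    also have "\<dots> \<le> prob (U n)" using U by (intro finite_measure_mono) (auto simp: U_def)
    finally show ?thesis .
  qed
  ultimately have "\<epsilon> \<le> prob (\<Inter>n. U n)"
    by (intro LIMSEQ_le_const[of "\<lambda>n. prob (U n)"]) auto
  then have "prob (\<Inter>n. U n) = 1"
    using borel_0_1_law[OF indep] \<open>0 < \<epsilon>\<close> by (auto simp: U_def)
  moreover have "(\<Inter>n. U n) \<in> events" using U by auto
  ultimately have "AE \<omega> in M. \<omega> \<in> (\<Inter>n. U n)" by (simp add: prob_eq_1)
  then show ?thesis
    by eventually_elim (auto simp: U_def infinite_nat_iff_unbounded_le)
qed

text \<open>
  Each of the disjoint finite sets \<open>K n\<close> has at most \<open>N\<close> vertices, so all its rotors have the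
  prescribed values with probability at least \<open>(1 / 4) ^ N\<close>, and these events are independent.
\<close>

lemma (in prob_space) uniform_rotors_agree_infinitely_often:
  fixes K :: "nat \<Rightarrow> complex set"
  assumes rotors: "uniform_rotors M \<rho>"
    and K: "\<And>n. K n \<subseteq> SG_vertices" "\<And>n. finite (K n)" "\<And>n. K n \<noteq> {}" "\<And>n. card (K n) \<le> N"
      "disjoint_family K"
    and g: "\<And>c. c \<in> SG_vertices \<Longrightarrow> g c \<in> {1..4}"
  shows "AE \<omega> in M. infinite {n. \<forall>c\<in>K n. \<rho> c \<omega> = g c}"
proof -
  define A where "A c = {\<omega> \<in> space M. \<rho> c \<omega> = g c}" for c
  have indep: "indep_vars (\<lambda>_. count_space {1..4}) \<rho> SG_vertices"
    using rotors by (simp add: uniform_rotors_def)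
  have distr: "distr M (count_space {1..4}) (\<rho> c) = uniform_count_measure {1..4}"
      if "c \<in> SG_vertices" for c
    using rotors that by (simp add: uniform_rotors_def)
  have A_indep: "indep_events A SG_vertices"
    unfolding A_def by (rule indep_eventsI_indep_vars[OF indep]) auto
  have prob_A: "prob (A c) = 1 / 4" if "c \<in> SG_vertices" for c
  proof -
    have "\<rho> c \<in> measurable M (count_space {1..4})"
      using indep that by (simp add: indep_vars_def)
    moreover have "A c = \<rho> c -` {g c} \<inter> space M" by (auto simp: A_def)
    ultimately have "prob (A c) = measure (distr M (count_space {1..4}) (\<rho> c)) {g c}"
      using g[OF that] by (simp add: measure_distr)
    also have "\<dots> = 1 / 4"
      using g[OF that] distr[OF that] by (simp add: measure_uniform_count_measure)
    finally show ?thesis .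
  qed
  have "(1 / 4) ^ N \<le> prob (\<Inter>c\<in>K n. A c)" for n
  proof -
    have "(1 / 4 :: real) ^ N \<le> (1 / 4) ^ card (K n)"
      using K(4) by (intro power_decreasing) auto
    also have "\<dots> = (\<Prod>c\<in>K n. prob (A c))"
    proof -
      have "(\<Prod>c\<in>K n. prob (A c)) = (\<Prod>c\<in>K n. 1 / 4)"
        using K(1) prob_A by (intro prod.cong) auto
      then show ?thesis by simp
    qed
    also have "\<dots> = prob (\<Inter>c\<in>K n. A c)"
      using A_indep K(1-3) by (simp add: indep_events_def)
    finally show ?thesis .
  qed
  then have "AE \<omega> in M. infinite {n. \<omega> \<in> (\<Inter>c\<in>K n. A c)}"
    using K A_indep
    by (intro AE_infinitely_often_indep[where \<epsilon> = "(1/4)^N"] indep_events_INT_disjoint) auto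
  then show ?thesis
    by eventually_elim (auto simp: A_def elim!: infinite_super[rotated])
qed

section \<open>Anticlockwise listings of an arc of directions\<close>

text \<open>
  The primitive sixth root of unity: all edges of the gasket have directions \<open>zeta ^ k\<close>.
\<close>

definition zeta :: complex where
  "zeta = Complex (1 / 2) (sqrt 3 / 2)"

lemma Re_zeta [simp]: "Re zeta = 1 / 2" and Im_zeta [simp]: "Im zeta = sqrt 3 / 2"
  by (simp_all add: zeta_def)

lemma zeta_eq_exp: "zeta = exp (\<i> * of_real (pi / 3))"
  by (simp add: complex_eq_iff Re_exp Im_exp cos_60 sin_60)

lemma zeta_squared: "zeta ^ 2 = zeta - 1"
  by (simp add: complex_eq_iff power2_eq_square field_simps)

lemma zeta_cubed: "zeta ^ 3 = -1"
  by (simp add: complex_eq_iff power3_eq_cube field_simps)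

lemma zeta_power_add6: "zeta ^ (k + 6) = zeta ^ k"
proof -
  have "zeta ^ 6 = (zeta ^ 3) ^ 2" by (simp flip: power_mult)
  then show ?thesis by (simp add: power_add zeta_cubed)
qed

lemma Arg2pi_zeta_power: "k < 6 \<Longrightarrow> Arg2pi (zeta ^ k) = real k * pi / 3"
  by (rule Arg2pi_unique[of 1])
     (simp_all add: zeta_eq_exp exp_of_nat_mult[symmetric] field_simps)

lemma Arg2pi_zeta_quotient:
  assumes "u \<noteq> 0" "k < 6" "l < 6"
  shows "Arg2pi ((u * zeta ^ k) / (u * zeta ^ l)) = real ((k + 6 - l) mod 6) * pi / 3"
proof -
  have "zeta \<noteq> 0" by (simp add: complex_eq_iff)
  have "(u * zeta ^ k) / (u * zeta ^ l) = zeta ^ (k + 6) / zeta ^ l"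
    using assms(1) by (simp add: zeta_power_add6)
  also have "\<dots> = zeta ^ (k + 6 - l)"
    using assms \<open>zeta \<noteq> 0\<close> by (intro power_diff[symmetric]) auto
  also have "\<dots> = zeta ^ ((k + 6 - l) mod 6)"
  proof (cases "l \<le> k")
    case True
    then have eq: "k + 6 - l = (k - l) + 6" by simp
    have "(k + 6 - l) mod 6 = (k - l) mod 6" unfolding eq by (rule mod_add_self2)
    also have "\<dots> = k - l" using assms(2) by (intro mod_less) simp
    finally show ?thesis using zeta_power_add6[of "k - l"] by (simp only: eq)
  next
    case False
    then have "k + 6 - l < 6" by simp
    then show ?thesis by (simp only: mod_less)
  qed
  finally show ?thesis by (simp only: Arg2pi_zeta_power[OF mod_less_divisor[OF zero_less_numeral]])
qed

text \<open>
  Four consecutive multiples of 60 degrees, numbered by \<open>0, 1, 2, 3\<close>, are listed anticlockwise from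
  the direction \<open>a 1\<close>; the angle from the first direction is \<open>(a i + 6 - a 1) mod 6\<close>, in units of
  60 degrees.  Whatever the first direction is, the listing runs through \<open>0, 1, 2, 3\<close> cyclically,
  since the directions form a single arc.
\<close>

lemma anticlockwise_is_cyclic_on_arc:
  fixes a :: "nat \<Rightarrow> nat"
  assumes "bij_betw a {1..4} {..<4}"
    and "strict_mono_on {1..4} (\<lambda>i. (a i + 6 - a 1) mod 6)"
    and "i \<in> {1..4}"
  shows "a (i mod 4 + 1) = (a i + 1) mod 4"
proof -
  have "a k \<in> set [0..<4]" if "k \<in> {1..4}" for k
    using bij_betwE[OF assms(1)] that by simp
  then have range: "a 1 \<in> set [0..<4]" "a 2 \<in> set [0..<4]" "a 3 \<in> set [0..<4]" "a 4 \<in> set [0..<4]"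
    by simp_all
  have mono: "(a 1 + 6 - a 1) mod 6 < (a 2 + 6 - a 1) mod 6"
    "(a 2 + 6 - a 1) mod 6 < (a 3 + 6 - a 1) mod 6"
    "(a 3 + 6 - a 1) mod 6 < (a 4 + 6 - a 1) mod 6"
    by (rule strict_mono_onD[OF assms(2)]; simp)+
  have check: "\<forall>w\<in>set [0..<4]. \<forall>x\<in>set [0..<4]. \<forall>y\<in>set [0..<4]. \<forall>z\<in>set [0..<4].
      (w + 6 - w) mod 6 < (x + 6 - w) mod 6 \<and> (x + 6 - w) mod 6 < (y + 6 - w) mod 6 \<and>
      (y + 6 - w) mod 6 < (z + 6 - w) mod 6 \<longrightarrow>
      x = (w + 1) mod 4 \<and> y = (x + 1) mod 4 \<and> z = (y + 1) mod 4 \<and> w = (z + 1) mod (4::nat)"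
    by code_simp
  have succ: "a 2 = (a 1 + 1) mod 4 \<and> a 3 = (a 2 + 1) mod 4 \<and> a 4 = (a 3 + 1) mod 4 \<and>
      a 1 = (a 4 + 1) mod 4"
    by (rule mp[OF bspec[OF bspec[OF bspec[OF bspec[OF check range(1)] range(2)] range(3)] range(4)]])
      (intro conjI mono)
  have "i = 1 \<or> i = 2 \<or> i = 3 \<or> i = 4" using assms(3) by auto
  moreover have "1 mod 4 + 1 = (2::nat)" "2 mod 4 + 1 = (3::nat)" "3 mod 4 + 1 = (4::nat)"
    "4 mod 4 + 1 = (1::nat)" by simp_all
  ultimately show ?thesis using succ by metis
qed

lemma inj_on_spokes:
  assumes "u \<noteq> 0"
  shows "inj_on (\<lambda>k. x + u * zeta ^ k) {..<4}"
proof (rule inj_onI)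
  fix k l :: nat assume kl: "k \<in> {..<4}" "l \<in> {..<4}" "x + u * zeta ^ k = x + u * zeta ^ l"
  then have "u * zeta ^ k = u * zeta ^ l" by (simp only: add_left_cancel)
  then have eq: "zeta ^ k = zeta ^ l" by (simp only: mult_left_cancel[OF assms])
  have "k < 6" "l < 6" using kl(1,2) by simp_all
  then have "real k * pi / 3 = real l * pi / 3"
    by (simp only: Arg2pi_zeta_power[symmetric] eq)
  then show "k = l" by simp
qed

text \<open>
  Consequently a suitable initial rotor sends the walk to two given adjacent directions of such an arc
  in its first two departures.  This is where the anticlockwise order is used: in a listing in which
  the two directions alternate with the two others, no initial rotor would do that.
\<close>

lemma rotor_towards_adjacent_pair:
  fixes f :: "nat \<Rightarrow> complex"
  assumes u: "u \<noteq> 0"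
    and bij: "bij_betw f {1..4} ((\<lambda>k. x + u * zeta ^ k) ` {..<4})"
    and mono: "strict_mono_on {1..4} (\<lambda>i. Arg2pi ((f i - x) / (f 1 - x)))"
    and "r < 4"
  shows "\<exists>i\<in>{1..4}. f (i mod 4 + 1) = x + u * zeta ^ r \<and>
           f ((i + 1) mod 4 + 1) = x + u * zeta ^ ((r + 1) mod 4)"
proof -
  define e where "e k = x + u * zeta ^ k" for k
  have inj: "inj_on e {..<4}"
    unfolding e_def[abs_def] using u by (rule inj_on_spokes)
  define a where "a = the_inv_into {..<4} e \<circ> f"
  have bij': "bij_betw f {1..4} (e ` {..<4})" using bij unfolding e_def[abs_def] .
  have a: "bij_betw a {1..4} {..<4}"
    unfolding a_def
    by (rule bij_betw_trans[OF bij' bij_betw_the_inv_into[OF inj_on_imp_bij_betw[OF inj]]])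
  have f: "f i = e (a i)" if "i \<in> {1..4}" for i
  proof -
    have "f i \<in> e ` {..<4}" using bij_betwE[OF bij'] that by blast
    then show ?thesis using f_the_inv_into_f[OF inj, of "f i"] by (simp only: a_def o_apply)
  qed
  have a_lt: "a i < 4" if "i \<in> {1..4}" for i using bij_betwE[OF a] that by auto
  define d where "d k = (a k + 6 - a 1) mod 6" for k
  have d: "Arg2pi ((f k - x) / (f 1 - x)) = real (d k) * pi / 3" if "k \<in> {1..4}" for k
  proof -
    have "f k - x = u * zeta ^ a k" "f 1 - x = u * zeta ^ a 1"
      using f[OF that] f[of 1] by (simp_all add: e_def)
    moreover have "a k < 6" "a 1 < 6" using a_lt[OF that] a_lt[of 1] by simp_all
    ultimately show ?thesis by (simp only: Arg2pi_zeta_quotient[OF u] d_def)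
  qed
  have "strict_mono_on {1..4} d"
  proof (rule strict_mono_onI)
    fix i j :: nat assume ij: "i \<in> {1..4}" "j \<in> {1..4}" "i < j"
    have "real (d i) * pi / 3 < real (d j) * pi / 3"
      using strict_mono_onD[OF mono ij] by (simp only: d ij)
    then show "d i < d j" by (simp add: divide_less_cancel)
  qed
  then have "strict_mono_on {1..4} (\<lambda>i. (a i + 6 - a 1) mod 6)"
    by (simp add: d_def[abs_def])
  then have succ: "a (i mod 4 + 1) = (a i + 1) mod 4" if "i \<in> {1..4}" for i
    using anticlockwise_is_cyclic_on_arc[OF a] that by blast
  \<comment> \<open>the rotor must initially point to the cyclic predecessor of \<open>r\<close>\<close>
  have "(r + 3) mod 4 \<in> a ` {1..4}" using a by (simp add: bij_betw_def)
  then obtain i where i: "i \<in> {1..4}" "a i = (r + 3) mod 4" by auto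
  define j where "j = i mod 4 + 1"
  have "j \<in> {1..4}" by (simp add: j_def)
  have "a j = (r + 3 + 1) mod 4"
    using succ[OF i(1)] i(2) unfolding j_def by (simp only: mod_add_left_eq)
  then have "a j = r" using \<open>r < 4\<close> by simp
  have "a (j mod 4 + 1) = (r + 1) mod 4"
    using succ[OF \<open>j \<in> {1..4}\<close>] \<open>a j = r\<close> by simp
  have "(i + 1) mod 4 + 1 = j mod 4 + 1" by (simp add: j_def mod_Suc_eq)
  have "f (i mod 4 + 1) = e r"
    using f[OF \<open>j \<in> {1..4}\<close>] \<open>a j = r\<close> by (simp only: j_def)
  moreover have "f ((i + 1) mod 4 + 1) = e ((r + 1) mod 4)"
    using f[of "j mod 4 + 1"] \<open>a (j mod 4 + 1) = (r + 1) mod 4\<close>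
    unfolding \<open>(i + 1) mod 4 + 1 = j mod 4 + 1\<close> by simp
  ultimately show ?thesis using i(1) unfolding e_def by blast
qed

section \<open>Blocks of the gasket and their corners\<close>

text \<open>
  In the right half plane, where every vertex has the form \<open>a + b * zeta\<close> with natural numbers \<open>a\<close> and
  \<open>b\<close>, the level is \<open>a + b\<close>.  It is invariant under the reflection, and its sublevel sets at powers
  of 2 are the finite blocks that make up the gasket.
\<close>

definition gasket_level :: "complex \<Rightarrow> real" where
  "gasket_level z = \<bar>Re z\<bar> + Im z / sqrt 3"

lemma gasket_level_0 [simp]: "gasket_level 0 = 0"
  by (simp add: gasket_level_def)

lemma gasket_level_add:
  "0 \<le> Re a \<Longrightarrow> 0 \<le> Re b \<Longrightarrow> gasket_level (a + b) = gasket_level a + gasket_level b"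
  by (simp add: gasket_level_def add_divide_distrib)

lemma gasket_level_corner: "d \<in> {1, zeta} \<Longrightarrow> gasket_level (2 ^ n *\<^sub>R d) = 2 ^ n"
  by (auto simp: gasket_level_def)

lemma gasket_level_unit: "d \<in> {1, zeta} \<Longrightarrow> gasket_level d = 1"
  using gasket_level_corner[of d 0] by simp

lemma SG_shifts_eq: "SG_shifts n = (\<lambda>d. 2 ^ n *\<^sub>R d) ` {0, 1, zeta}"
  by (simp add: SG_shifts_def complex_eq_iff set_eq_iff)

lemma SG_V_0: "SG_V 0 = {0, 1, zeta}"
  by (simp add: complex_eq_iff set_eq_iff)

lemma SG_V_Suc: "SG_V (Suc n) = (\<Union>d\<in>{0, 1, zeta}. (\<lambda>v. 2 ^ n *\<^sub>R d + v) ` SG_V n)"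
  by (simp add: SG_shifts_eq)

lemma SG_E_Suc: "SG_E (Suc n) = (\<Union>d\<in>{0, 1, zeta}. (\<lambda>e. (\<lambda>v. 2 ^ n *\<^sub>R d + v) ` e) ` SG_E n)"
  by (simp add: SG_shifts_eq)

lemma SG_E_0: "d \<in> {0, 1, zeta} \<Longrightarrow> d' \<in> {0, 1, zeta} \<Longrightarrow> d \<noteq> d' \<Longrightarrow> {d, d'} \<in> SG_E 0"
  unfolding SG_E.simps(1) SG_V_0 by blast

declare SG_V.simps [simp del] SG_E.simps [simp del]

lemma finite_SG_V: "finite (SG_V n)"
  by (induction n) (auto simp: SG_V_0 SG_V_Suc)

lemma SG_V_bounds:
  "v \<in> SG_V n \<Longrightarrow> 0 \<le> Re v \<and> 0 \<le> Im v \<and> gasket_level v \<le> 2 ^ n"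
proof (induction n arbitrary: v)
  case 0
  then show ?case by (auto simp: SG_V_0 gasket_level_unit)
next
  case (Suc n)
  then obtain d v' where v: "d \<in> {0, 1, zeta}" "v' \<in> SG_V n" "v = 2 ^ n *\<^sub>R d + v'"
    unfolding SG_V_Suc by blast
  have d: "0 \<le> Re d" "0 \<le> Im d" using v(1) by auto
  have "gasket_level (2 ^ n *\<^sub>R d) \<le> 2 ^ n"
    using v(1) gasket_level_corner[of d n] by auto
  then show ?case
    using Suc.IH[OF v(2)] d by (simp add: v(3) gasket_level_add)
qed

lemma SG_E_subset: "e \<in> SG_E n \<Longrightarrow> e \<subseteq> SG_V n"
proof (induction n arbitrary: e)
  case 0
  then show ?case by (auto simp: SG_E.simps(1))
next
  case (Suc n)
  then show ?case unfolding SG_V_Suc SG_E_Suc by blast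
qed

lemma SG_V_mono: "m \<le> n \<Longrightarrow> SG_V m \<subseteq> SG_V n"
proof (rule lift_Suc_mono_le[of SG_V])
  show "SG_V k \<subseteq> SG_V (Suc k)" for k by (auto simp: SG_V_Suc)
qed

lemma double_corner: "2 ^ Suc n *\<^sub>R d = 2 ^ n *\<^sub>R d + 2 ^ n *\<^sub>R (d :: complex)"
  by (simp flip: scaleR_add_left)

lemma corner_in_SG_V: "d \<in> {0, 1, zeta} \<Longrightarrow> 2 ^ n *\<^sub>R d \<in> SG_V n"
proof (induction n)
  case 0
  then show ?case by (simp add: SG_V_0)
next
  case (Suc n)
  then show ?case unfolding SG_V_Suc double_corner by blast
qed

lemma corner_edge:
  assumes "d \<in> {0, 1, zeta}" "d' \<in> {0, 1, zeta}" "d \<noteq> d'"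
  shows "{2 ^ n *\<^sub>R d, 2 ^ n *\<^sub>R d + (d' - d)} \<in> SG_E n"
proof (induction n)
  case 0
  then show ?case using SG_E_0[OF assms] by simp
next
  case (Suc n)
  have "{2 ^ Suc n *\<^sub>R d, 2 ^ Suc n *\<^sub>R d + (d' - d)} =
      (\<lambda>v. 2 ^ n *\<^sub>R d + v) ` {2 ^ n *\<^sub>R d, 2 ^ n *\<^sub>R d + (d' - d)}"
    unfolding double_corner by (simp add: add.assoc)
  then show ?case using Suc assms(1) unfolding SG_E_Suc by blast
qed

text \<open>
  A translated copy starts at the level \<open>2 ^ m\<close> of its lowest corner, and this corner is the only point
  of the copy at that level.  A point of the copy with level at most \<open>2 ^ n\<close> is therefore this corner,
  and \<open>m\<close> equals \<open>n\<close>.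
\<close>

lemma shift_low_level:
  assumes d: "d \<in> {1, zeta}" and v: "v \<in> SG_V m"
    and low: "gasket_level (2 ^ m *\<^sub>R d + v) \<le> 2 ^ n" and "n \<le> m"
  shows "2 ^ m *\<^sub>R d + v = 2 ^ n *\<^sub>R d"
proof -
  have "0 \<le> Re d" using d by auto
  then have "2 ^ m + gasket_level v \<le> 2 ^ n"
    using low SG_V_bounds[OF v] gasket_level_corner[OF d, of m] by (simp add: gasket_level_add)
  moreover have "0 \<le> Im v / sqrt 3" using SG_V_bounds[OF v] by simp
  moreover have "(2::real) ^ n \<le> 2 ^ m" using \<open>n \<le> m\<close> by simp
  ultimately have "(2::real) ^ n = 2 ^ m" "Re v = 0" "Im v / sqrt 3 = 0"
    using SG_V_bounds[OF v] unfolding gasket_level_def by linarith+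
  then show ?thesis by (simp add: complex_eq_iff)
qed

text \<open>
  Later stages attach their copies above the level \<open>2 ^ n\<close>, or at a corner that is already there.
\<close>

lemma SG_V_low_level:
  assumes "v \<in> SG_V m" "gasket_level v \<le> 2 ^ n"
  shows "v \<in> SG_V n"
  using assms
proof (induction m arbitrary: v)
  case 0
  then show ?case using SG_V_mono[of 0 n] by auto
next
  case (Suc m)
  show ?case
  proof (cases "Suc m \<le> n")
    case True
    then show ?thesis using SG_V_mono[of "Suc m" n] Suc.prems by blast
  next
    case False
    obtain d v' where v: "d \<in> {0, 1, zeta}" "v' \<in> SG_V m" "v = 2 ^ m *\<^sub>R d + v'"
      using Suc.prems unfolding SG_V_Suc by blast
    show ?thesis
    proof (cases "d = 0")
      case True
      then show ?thesis using Suc v by simp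
    next
      case False
      then have d: "d \<in> {1, zeta}" using v(1) by simp
      show ?thesis
        using shift_low_level[OF d v(2)] Suc.prems(2) \<open>\<not> Suc m \<le> n\<close>
          corner_in_SG_V[OF v(1), of n] v(3) by auto
    qed
  qed
qed

text \<open>
  Each edge lies in one copy, so it can leave the levels up to \<open>2 ^ n\<close> only inside a copy attached
  above a corner of the block, and it then starts at that corner.
\<close>

lemma edge_leaving_low_level:
  assumes "{z, w} \<in> SG_E m" "gasket_level z \<le> 2 ^ n" "2 ^ n < gasket_level w"
  shows "z \<in> (\<lambda>d. 2 ^ n *\<^sub>R d) ` {1, zeta}"
  using assms
proof (induction m arbitrary: z w)
  case 0
  have "w \<in> SG_V 0" using SG_E_subset[OF 0(1)] by simp
  then have "gasket_level w \<le> 1" using SG_V_bounds[of w 0] by simp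
  also have "1 \<le> (2 :: real) ^ n" by simp
  finally show ?case using 0 by simp
next
  case (Suc m)
  have "w \<in> SG_V (Suc m)" using SG_E_subset[OF Suc.prems(1)] by simp
  then have "gasket_level w \<le> 2 ^ Suc m" using SG_V_bounds by blast
  then have "(2::real) ^ n < 2 ^ Suc m" using Suc.prems by linarith
  then have "n < Suc m" by (rule power_less_imp_less_exp[rotated]) simp
  then have "n \<le> m" by simp
  obtain d e where e: "d \<in> {0, 1, zeta}" "e \<in> SG_E m" "{z, w} = (\<lambda>v. 2 ^ m *\<^sub>R d + v) ` e"
    using Suc.prems unfolding SG_E_Suc by blast
  then obtain z' where z': "z' \<in> e" "z = 2 ^ m *\<^sub>R d + z'" by blast
  show ?case
  proof (cases "d = 0")
    case True
    then have "{z, w} = e" using e(3) by simp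
    then show ?thesis using Suc.IH Suc.prems e(2) by blast
  next
    case False
    then have d: "d \<in> {1, zeta}" using e(1) by simp
    have "z' \<in> SG_V m" using SG_E_subset[OF e(2)] z' by blast
    then show ?thesis using shift_low_level[OF d] Suc.prems(2) \<open>n \<le> m\<close> z'(2) d by auto
  qed
qed

lemma reflect_reflect [simp]: "SG_reflect (SG_reflect z) = z"
  by (simp add: SG_reflect_def)

lemma reflect_0 [simp]: "SG_reflect 0 = 0"
  by (simp add: SG_reflect_def complex_eq_iff)

lemma reflect_add: "SG_reflect (a + b) = SG_reflect a + SG_reflect b"
  by (simp add: SG_reflect_def complex_eq_iff)

lemma gasket_level_reflect [simp]: "gasket_level (SG_reflect z) = gasket_level z"
  by (simp add: SG_reflect_def gasket_level_def)

text \<open>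
  The reflection is an involution, so membership in the left half can be tested by reflecting back,
  which reduces questions about both halves to the right one.
\<close>

lemma SG_vertices_iff: "z \<in> SG_vertices \<longleftrightarrow> (\<exists>m. z \<in> SG_V m \<or> SG_reflect z \<in> SG_V m)"
proof -
  have "z \<in> SG_reflect ` A \<longleftrightarrow> SG_reflect z \<in> A" for A
    by (metis imageE imageI reflect_reflect)
  then show ?thesis unfolding SG_vertices_def by simp blast
qed

lemma SG_edges_iff:
  "{x, y} \<in> SG_edges \<longleftrightarrow> (\<exists>m. {x, y} \<in> SG_E m \<or> {SG_reflect x, SG_reflect y} \<in> SG_E m)"
proof
  assume "{x, y} \<in> SG_edges"
  then obtain m e where "e \<in> SG_E m" "{x, y} = e \<or> {x, y} = SG_reflect ` e"
    unfolding SG_edges_def by blast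
  moreover have "{SG_reflect x, SG_reflect y} = e" if "{x, y} = SG_reflect ` e"
  proof -
    have "SG_reflect ` {x, y} = e" unfolding that by (simp add: image_image)
    then show ?thesis by simp
  qed
  ultimately show "\<exists>m. {x, y} \<in> SG_E m \<or> {SG_reflect x, SG_reflect y} \<in> SG_E m"
    by blast
next
  have "{x, y} \<in> SG_edges" if "{SG_reflect x, SG_reflect y} \<in> SG_E m" for m
  proof -
    have "{x, y} = SG_reflect ` {SG_reflect x, SG_reflect y}" by simp
    then show ?thesis using that unfolding SG_edges_def by blast
  qed
  then show "{x, y} \<in> SG_edges"
    if "\<exists>m. {x, y} \<in> SG_E m \<or> {SG_reflect x, SG_reflect y} \<in> SG_E m"
    using that unfolding SG_edges_def by blast
qed

lemma SG_neighbours_iff: "y \<in> SG_neighbours x \<longleftrightarrow> {x, y} \<in> SG_edges"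
  by (simp add: SG_neighbours_def)

lemma SG_neighbours_sym: "y \<in> SG_neighbours x \<Longrightarrow> x \<in> SG_neighbours y"
  by (simp add: SG_neighbours_iff insert_commute)

lemma SG_neighbours_reflect:
  "SG_reflect y \<in> SG_neighbours (SG_reflect x) \<longleftrightarrow> y \<in> SG_neighbours x"
  by (auto simp: SG_neighbours_iff SG_edges_iff)

lemma SG_neighbours_subset: "SG_neighbours x \<subseteq> SG_vertices"
proof
  fix y assume "y \<in> SG_neighbours x"
  then obtain m where "{x, y} \<in> SG_E m \<or> {SG_reflect x, SG_reflect y} \<in> SG_E m"
    unfolding SG_neighbours_iff SG_edges_iff by blast
  then have "y \<in> SG_V m \<or> SG_reflect y \<in> SG_V m"
    using SG_E_subset by blast
  then show "y \<in> SG_vertices" unfolding SG_vertices_iff by blast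
qed

lemma SG_reflect_vertices: "SG_reflect z \<in> SG_vertices \<longleftrightarrow> z \<in> SG_vertices"
  by (auto simp: SG_vertices_iff)

definition gasket_block :: "nat \<Rightarrow> complex set" where
  "gasket_block n = {z \<in> SG_vertices. gasket_level z \<le> 2 ^ n}"

text \<open>
  The cut points of the block: its corners other than the origin, in both halves of the gasket.
\<close>

definition gasket_corners :: "nat \<Rightarrow> complex set" where
  "gasket_corners n = (\<Union>d\<in>{1, zeta}. {2 ^ n *\<^sub>R d, SG_reflect (2 ^ n *\<^sub>R d)})"

lemma reflect_gasket_block: "SG_reflect z \<in> gasket_block n \<longleftrightarrow> z \<in> gasket_block n"
  by (simp add: gasket_block_def SG_reflect_vertices)

lemma finite_gasket_block: "finite (gasket_block n)"
proof (rule finite_subset)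
  show "gasket_block n \<subseteq> SG_V n \<union> SG_reflect ` SG_V n"
  proof
    fix z assume z: "z \<in> gasket_block n"
    then obtain m where "z \<in> SG_V m \<or> SG_reflect z \<in> SG_V m"
      by (auto simp: gasket_block_def SG_vertices_iff)
    then have "z \<in> SG_V n \<or> SG_reflect z \<in> SG_V n"
      using z SG_V_low_level[of z m n] SG_V_low_level[of "SG_reflect z" m n]
      by (auto simp: gasket_block_def)
    moreover have "z = SG_reflect (SG_reflect z)" by simp
    ultimately show "z \<in> SG_V n \<union> SG_reflect ` SG_V n" by blast
  qed
qed (simp add: finite_SG_V)

lemma origin_in_SG_V: "0 \<in> SG_V n"
  using corner_in_SG_V[of 0 n] by simp

lemma origin_in_gasket_block: "0 \<in> gasket_block n"
  using origin_in_SG_V[of 0] by (auto simp: gasket_block_def SG_vertices_iff)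

lemma gasket_corners_subset: "gasket_corners n \<subseteq> SG_vertices"
proof -
  have "2 ^ n *\<^sub>R d \<in> SG_vertices" if "d \<in> {1, zeta}" for d
    using corner_in_SG_V[of d n] that unfolding SG_vertices_iff by blast
  then show ?thesis unfolding gasket_corners_def using SG_reflect_vertices by auto
qed

lemma gasket_level_corners: "c \<in> gasket_corners n \<Longrightarrow> gasket_level c = 2 ^ n"
  using gasket_level_corner[of 1 n] gasket_level_corner[of zeta n]
  unfolding gasket_corners_def by auto

lemma disjoint_gasket_corners: "disjoint_family gasket_corners"
proof (unfold disjoint_family_on_def, intro ballI impI)
  fix m n :: nat assume "m \<noteq> n"
  have "(2::real) ^ m \<noteq> 2 ^ n" using \<open>m \<noteq> n\<close> by simp
  then show "gasket_corners m \<inter> gasket_corners n = {}"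
    using gasket_level_corners by (metis disjoint_iff)
qed

lemma finite_gasket_corners: "finite (gasket_corners n)"
  by (simp add: gasket_corners_def)

lemma card_gasket_corners: "card (gasket_corners n) \<le> 4"
proof -
  have "gasket_corners n = set [2 ^ n *\<^sub>R 1, SG_reflect (2 ^ n *\<^sub>R 1),
      2 ^ n *\<^sub>R zeta, SG_reflect (2 ^ n *\<^sub>R zeta)]"
    unfolding gasket_corners_def by auto
  also have "card \<dots> \<le> 4" by (rule order_trans[OF card_length]) simp
  finally show ?thesis .
qed

lemma gasket_corners_nonempty: "gasket_corners n \<noteq> {}"
  by (simp add: gasket_corners_def)

lemma gasket_block_exit:
  assumes "z \<in> gasket_block n" "w \<in> SG_neighbours z" "w \<notin> gasket_block n"
  shows "z \<in> gasket_corners n"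
proof -
  have level: "gasket_level z \<le> 2 ^ n" "2 ^ n < gasket_level w"
    using assms SG_neighbours_subset by (auto simp: gasket_block_def)
  obtain m where "{z, w} \<in> SG_E m \<or> {SG_reflect z, SG_reflect w} \<in> SG_E m"
    using assms(2) unfolding SG_neighbours_iff SG_edges_iff by blast
  then have "z \<in> (\<lambda>d. 2 ^ n *\<^sub>R d) ` {1, zeta} \<or> SG_reflect z \<in> (\<lambda>d. 2 ^ n *\<^sub>R d) ` {1, zeta}"
    using edge_leaving_low_level[of z w m n] level
      edge_leaving_low_level[of "SG_reflect z" "SG_reflect w" m n] by auto
  then show ?thesis
  proof
    assume "SG_reflect z \<in> (\<lambda>d. 2 ^ n *\<^sub>R d) ` {1, zeta}"
    then obtain d where "d \<in> {1, zeta}" "SG_reflect z = 2 ^ n *\<^sub>R d" by blast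
    moreover from this(2) have "z = SG_reflect (2 ^ n *\<^sub>R d)" by (metis reflect_reflect)
    ultimately show ?thesis unfolding gasket_corners_def by blast
  qed (auto simp: gasket_corners_def)
qed

text \<open>
  Each copy is attached to the previous stage in its lowest corner, so paths inside a copy can be
  prolonged to the origin.
\<close>

lemma gasket_connected:
  assumes "v \<in> SG_vertices"
  shows "(0, v) \<in> {(x, y). y \<in> SG_neighbours x}\<^sup>*"
proof -
  define R where "R = {(x, y). y \<in> SG_neighbours x}"
  define Q where "Q m = {(x, y). {x, y} \<in> SG_E m}" for m
  have mono: "(Q m)\<^sup>* \<subseteq> (Q (Suc m))\<^sup>*" for m
    by (intro rtrancl_mono) (auto simp: Q_def SG_E_Suc)
  have shift: "(2 ^ m *\<^sub>R d + x, 2 ^ m *\<^sub>R d + y) \<in> (Q (Suc m))\<^sup>*"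
    if "d \<in> {0, 1, zeta}" "(x, y) \<in> (Q m)\<^sup>*" for m d x y
    using that(2)
  proof (induction rule: rtrancl_induct)
    case (step y z)
    have "(\<lambda>v. 2 ^ m *\<^sub>R d + v) ` {y, z} \<in> SG_E (Suc m)"
      using step.hyps(2) that(1) unfolding SG_E_Suc Q_def by blast
    then have "(2 ^ m *\<^sub>R d + y, 2 ^ m *\<^sub>R d + z) \<in> Q (Suc m)" by (simp add: Q_def)
    then show ?case using step.IH by (rule rtrancl_into_rtrancl[rotated])
  qed simp
  have reach: "(0, v) \<in> (Q m)\<^sup>*" if "v \<in> SG_V m" for m v
    using that
  proof (induction m arbitrary: v)
    case 0
    have "(0, v) \<in> Q 0" if "v \<noteq> 0"
      using SG_E_0[of 0 v] 0 that by (simp add: Q_def SG_V_0)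
    then show ?case by (cases "v = 0") auto
  next
    case (Suc m)
    then obtain d v' where v: "d \<in> {0, 1, zeta}" "v' \<in> SG_V m" "v = 2 ^ m *\<^sub>R d + v'"
      unfolding SG_V_Suc by blast
    have "(0, 2 ^ m *\<^sub>R d) \<in> (Q (Suc m))\<^sup>*"
      using Suc.IH[OF corner_in_SG_V[OF v(1)]] mono by blast
    moreover have "(2 ^ m *\<^sub>R d, v) \<in> (Q (Suc m))\<^sup>*"
      using shift[OF v(1) Suc.IH[OF v(2)]] by (simp add: v(3))
    ultimately show ?case by (rule rtrancl_trans)
  qed
  have sub: "(Q m)\<^sup>* \<subseteq> R\<^sup>*" for m
    by (intro rtrancl_mono) (auto simp: Q_def R_def SG_neighbours_iff SG_edges_iff)
  obtain m where "v \<in> SG_V m \<or> SG_reflect v \<in> SG_V m"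
    using assms SG_vertices_iff by blast
  then have "(0, v) \<in> R\<^sup>* \<or> (0, SG_reflect v) \<in> R\<^sup>*"
    using reach sub by blast
  moreover have "(SG_reflect x, SG_reflect y) \<in> R\<^sup>*" if "(x, y) \<in> R\<^sup>*" for x y
    using that
  proof (induction rule: rtrancl_induct)
    case (step y z)
    then have "(SG_reflect y, SG_reflect z) \<in> R" by (simp add: R_def SG_neighbours_reflect)
    then show ?case using step.IH by (rule rtrancl_into_rtrancl[rotated])
  qed simp
  ultimately have "(0, v) \<in> R\<^sup>*" by (metis reflect_0 reflect_reflect)
  then show ?thesis by (simp only: R_def)
qed

text \<open>
  At a corner in direction \<open>d\<close> the edges of the block lead towards the two other corners, and those of
  the copy attached there lead in the directions \<open>1\<close> and \<open>zeta\<close>.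
\<close>

lemma corner_neighbours:
  assumes d: "d \<in> {1, zeta}" and d': "d' \<in> {0, 1, zeta}"
  shows "d' \<noteq> d \<Longrightarrow> 2 ^ n *\<^sub>R d + (d' - d) \<in> SG_neighbours (2 ^ n *\<^sub>R d) \<inter> gasket_block n"
    and "d' \<noteq> 0 \<Longrightarrow> 2 ^ n *\<^sub>R d + d' \<in> SG_neighbours (2 ^ n *\<^sub>R d) - gasket_block n"
proof -
  have d0: "d \<in> {0, 1, zeta}" using d by blast
  show "2 ^ n *\<^sub>R d + (d' - d) \<in> SG_neighbours (2 ^ n *\<^sub>R d) \<inter> gasket_block n" if "d' \<noteq> d"
  proof -
    have e: "{2 ^ n *\<^sub>R d, 2 ^ n *\<^sub>R d + (d' - d)} \<in> SG_E n"
      using corner_edge[OF d0 d'] that by blast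
    then have "2 ^ n *\<^sub>R d + (d' - d) \<in> SG_V n" using SG_E_subset by blast
    then have "2 ^ n *\<^sub>R d + (d' - d) \<in> gasket_block n"
      using SG_V_bounds unfolding gasket_block_def SG_vertices_iff by blast
    then show ?thesis using e unfolding SG_neighbours_iff SG_edges_iff Int_iff by blast
  qed
  show "2 ^ n *\<^sub>R d + d' \<in> SG_neighbours (2 ^ n *\<^sub>R d) - gasket_block n" if "d' \<noteq> 0"
  proof -
    have "{0, d'} \<in> SG_E n" using corner_edge[of 0 d' n] d' that by simp
    then have "(\<lambda>v. 2 ^ n *\<^sub>R d + v) ` {0, d'} \<in> SG_E (Suc n)"
      using d0 unfolding SG_E_Suc by blast
    then have "{2 ^ n *\<^sub>R d, 2 ^ n *\<^sub>R d + d'} \<in> SG_E (Suc n)" by simp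
    then have "2 ^ n *\<^sub>R d + d' \<in> SG_neighbours (2 ^ n *\<^sub>R d)"
      unfolding SG_neighbours_iff SG_edges_iff by blast
    moreover have "d' \<in> {1, zeta}" using d' that by blast
    then have "gasket_level (2 ^ n *\<^sub>R d + d') = 2 ^ n + 1"
      using d gasket_level_corner[OF d, of n] gasket_level_unit[of d']
      by (subst gasket_level_add) auto
    ultimately show ?thesis by (simp add: gasket_block_def)
  qed
qed

text \<open>
  Around a corner, the two edges of the block and the two edges of the copy attached to it fill an arc
  of consecutive directions \<open>u, u * zeta, u * zeta ^ 2, u * zeta ^ 3\<close>, of which the edges of the block
  are the first pair (\<open>r = 0\<close>) or the last pair (\<open>r = 2\<close>).  The arc starts at \<open>u = 1\<close> for the two
  corners on the real axis, at \<open>u = - zeta\<close> for the upper right corner and at \<open>u = zeta ^ 2\<close> for the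
  upper left one.  The reflection reverses the orientation and thus exchanges the two pairs.
\<close>

lemma gasket_corner_spokes:
  assumes "c \<in> gasket_corners n"
  obtains u r where "u \<noteq> 0" "r \<in> {0, 2}"
    "(\<lambda>k. c + u * zeta ^ k) ` {..<4} \<subseteq> SG_neighbours c"
    "\<And>k. k < 4 \<Longrightarrow> c + u * zeta ^ k \<in> gasket_block n \<longleftrightarrow> k \<in> {r, r + 1}"
proof -
  note witness = that
  let ?A = "\<lambda>c y. c + y \<in> SG_neighbours c \<and> c + y \<in> gasket_block n"
  let ?Z = "\<lambda>c y. c + y \<in> SG_neighbours c \<and> c + y \<notin> gasket_block n"
  have reflect: "?A (SG_reflect c) (SG_reflect y) = ?A c y"
    "?Z (SG_reflect c) (SG_reflect y) = ?Z c y" for c y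
    using SG_neighbours_reflect[of "c + y" c] reflect_gasket_block[of "c + y" n]
    by (simp_all add: reflect_add)
  have zeta_ne: "zeta \<noteq> 0" "zeta \<noteq> 1" by (simp_all add: complex_eq_iff)
  \<comment> \<open>the last two directions are written without powers: \<open>zeta ^ 2 = zeta - 1\<close> and \<open>zeta ^ 3 = - 1\<close>\<close>
  have spokes: thesis
    if "u \<noteq> 0" "r = 0 \<and> ?A c u \<and> ?A c (u * zeta) \<and> ?Z c (u * (zeta - 1)) \<and> ?Z c (- u) \<or>
      r = 2 \<and> ?Z c u \<and> ?Z c (u * zeta) \<and> ?A c (u * (zeta - 1)) \<and> ?A c (- u)" for u and r :: nat
  proof (rule witness[of u r])
    have pow: "u * zeta ^ 0 = u" "u * zeta ^ 1 = u * zeta" "u * zeta ^ 2 = u * (zeta - 1)"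
      "u * zeta ^ 3 = - u"
      by (simp_all add: zeta_squared zeta_cubed)
    have fours: "{..<4::nat} = {0, 1, 2, 3}" by auto
    show "(\<lambda>k. c + u * zeta ^ k) ` {..<4} \<subseteq> SG_neighbours c"
      unfolding fours image_insert image_empty pow using that(2) by blast
    note cases = that(2)
    show "c + u * zeta ^ k \<in> gasket_block n \<longleftrightarrow> k \<in> {r, r + 1}" if "k < 4" for k
    proof -
      have "k = 0 \<or> k = 1 \<or> k = 2 \<or> k = 3" using \<open>k < 4\<close> by auto
      then show ?thesis
        using cases by (elim disjE conjE; simp only: pow) simp_all
    qed
  qed (use that in auto)
  have zz: "zeta * zeta = zeta - 1" using zeta_squared by (simp only: power2_eq_square)
  have reflect_units: "SG_reflect 1 = - 1" "SG_reflect zeta = zeta - 1" "SG_reflect (- 1) = 1"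
    "SG_reflect (zeta - 1) = zeta" "SG_reflect (- zeta) = 1 - zeta"
    "SG_reflect (1 - zeta) = - zeta"
    by (simp_all add: SG_reflect_def complex_eq_iff)
  obtain d where d: "d \<in> {1, zeta}" "c = 2 ^ n *\<^sub>R d \<or> c = SG_reflect (2 ^ n *\<^sub>R d)"
    using assms unfolding gasket_corners_def by blast
  define b where "b = 2 ^ n *\<^sub>R d"
  have inner: "?A b (d' - d)" if "d' \<in> {0, 1, zeta}" "d' \<noteq> d" for d'
    using corner_neighbours(1)[OF d(1) that] by (simp add: b_def)
  have outer: "?Z b d'" if "d' \<in> {1, zeta}" for d'
    using corner_neighbours(2)[OF d(1), of d' n] that zeta_ne by (auto simp: b_def)
  have c: "c = b \<or> c = SG_reflect b" using d(2) by (simp only: b_def)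
  show thesis
  proof (cases "d = 1")
    case True
    then have A: "?A b (- 1)" "?A b (zeta - 1)" and Z: "?Z b 1" "?Z b zeta"
      using inner[of 0] inner[of zeta] outer[of 1] outer[of zeta] zeta_ne by simp_all
    from c show thesis
    proof
      assume "c = b"
      then show thesis using A Z by (intro spokes[of 1 2]) simp_all
    next
      assume c: "c = SG_reflect b"
      have "?A c 1" "?A c zeta" "?Z c (- 1)" "?Z c (zeta - 1)"
        using A Z unfolding c reflect[symmetric, of b] reflect_units by blast+
      then show thesis by (intro spokes[of 1 0]) simp_all
    qed
  next
    case False
    then have "d = zeta" using d(1) by simp
    then have A: "?A b (- zeta)" "?A b (1 - zeta)" and Z: "?Z b 1" "?Z b zeta"
      using inner[of 0] inner[of 1] outer[of 1] outer[of zeta] zeta_ne by simp_all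
    from c show thesis
    proof
      assume "c = b"
      moreover have "- zeta * zeta = 1 - zeta" "- zeta * (zeta - 1) = 1"
        by (simp_all add: zz algebra_simps)
      ultimately show thesis using A Z zeta_ne by (intro spokes[of "- zeta" 0]) simp_all
    next
      assume c: "c = SG_reflect b"
      have "?A c (- zeta)" "?A c (1 - zeta)" "?Z c (- 1)" "?Z c (zeta - 1)"
        using A Z unfolding c reflect[symmetric, of b] reflect_units by blast+
      moreover have "(zeta - 1) * zeta = - 1" "(zeta - 1) * (zeta - 1) = - zeta"
        by (simp_all add: zz algebra_simps)
      ultimately show thesis using zeta_ne by (intro spokes[of "zeta - 1" 2]) simp_all
    qed
  qed
qed

section \<open>Recurrence on the gasket\<close>

lemma rotor_graph_SG:
  "anticlockwise_listing cyc \<Longrightarrow> rotor_graph SG_vertices SG_neighbours cyc"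
  unfolding anticlockwise_listing_def
  by unfold_locales (auto intro: SG_neighbours_sym dest: subsetD[OF SG_neighbours_subset])

text \<open>
  The listing has exactly four entries, so the four neighbours found above are all neighbours of the
  corner, and the listing runs through a single arc.
\<close>

lemma corner_rotor_inwards:
  assumes cyc: "anticlockwise_listing cyc" and c: "c \<in> gasket_corners n"
  shows "card (SG_neighbours c \<inter> gasket_block n) \<le> 2"
    and "\<exists>i\<in>{1..4}. cyc c (i mod 4 + 1) \<in> gasket_block n \<and>
           cyc c ((i + 1) mod 4 + 1) \<in> gasket_block n"
proof -
  interpret rotor_graph SG_vertices SG_neighbours cyc
    using cyc by (rule rotor_graph_SG)
  have cV: "c \<in> SG_vertices" using c gasket_corners_subset by blast
  obtain u r where u: "u \<noteq> 0" and r: "r \<in> {0, 2}"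
    and sub: "(\<lambda>k. c + u * zeta ^ k) ` {..<4} \<subseteq> SG_neighbours c"
    and inner: "\<And>k. k < 4 \<Longrightarrow> c + u * zeta ^ k \<in> gasket_block n \<longleftrightarrow> k \<in> {r, r + 1}"
    using gasket_corner_spokes[OF c] by blast
  have "card ((\<lambda>k. c + u * zeta ^ k) ` {..<4}) = card (SG_neighbours c)"
    using card_image[OF inj_on_spokes[OF u]] card_nbr[OF cV] by simp
  then have spokes: "SG_neighbours c = (\<lambda>k. c + u * zeta ^ k) ` {..<4}"
    using card_subset_eq[OF finite_nbr[OF cV] sub] by simp
  have "SG_neighbours c \<inter> gasket_block n \<subseteq> (\<lambda>k. c + u * zeta ^ k) ` {r, r + 1}"
    using inner unfolding spokes by blast
  then have "card (SG_neighbours c \<inter> gasket_block n) \<le> card {r, r + 1}"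
    by (rule surj_card_le[rotated]) simp
  then show "card (SG_neighbours c \<inter> gasket_block n) \<le> 2" by simp
  have "r < 4" "r + 1 < 4" "(r + 1) mod 4 = r + 1" using r by auto
  moreover have "bij_betw (cyc c) {1..4} ((\<lambda>k. c + u * zeta ^ k) ` {..<4})"
    "strict_mono_on {1..4} (\<lambda>i. Arg2pi ((cyc c i - c) / (cyc c 1 - c)))"
    using cyc cV unfolding spokes[symmetric] anticlockwise_listing_def by blast+
  ultimately obtain i where i: "i \<in> {1..4}" "cyc c (i mod 4 + 1) = c + u * zeta ^ r"
      "cyc c ((i + 1) mod 4 + 1) = c + u * zeta ^ (r + 1)"
    using rotor_towards_adjacent_pair[OF u, of "cyc c" c r] by auto
  then show "\<exists>i\<in>{1..4}. cyc c (i mod 4 + 1) \<in> gasket_block n \<and>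
      cyc c ((i + 1) mod 4 + 1) \<in> gasket_block n"
    using inner[OF \<open>r < 4\<close>] inner[OF \<open>r + 1 < 4\<close>]
    by (intro bexI[OF _ i(1)]) (simp only: i(2,3), simp)
qed

theorem theorem1p1:
  fixes M :: "'w measure"
    and cyc :: "complex \<Rightarrow> nat \<Rightarrow> complex"
    and \<rho> :: "complex \<Rightarrow> 'w \<Rightarrow> nat"
  assumes "prob_space M"
    and "anticlockwise_listing cyc"
    and "uniform_rotors M \<rho>"
  shows "AE \<omega> in M. \<forall>x\<in>SG_vertices.
           infinite {t. rotor_walk cyc (\<lambda>v. \<rho> v \<omega>) 0 t = x}"
proof -
  interpret prob_space M by fact
  interpret rotor_graph SG_vertices SG_neighbours cyc
    using assms(2) by (rule rotor_graph_SG)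
  define inwards where "inwards n c i \<longleftrightarrow> cyc c (i mod 4 + 1) \<in> gasket_block n \<and>
      cyc c ((i + 1) mod 4 + 1) \<in> gasket_block n" for n c i
  \<comment> \<open>the corner sets are disjoint, so one value per vertex serves all \<open>n\<close>\<close>
  have "\<exists>i\<in>{1..4}. \<forall>n. c \<in> gasket_corners n \<longrightarrow> inwards n c i" for c
  proof (cases "\<exists>n. c \<in> gasket_corners n")
    case True
    then obtain n where n: "c \<in> gasket_corners n" by blast
    then have "m = n" if "c \<in> gasket_corners m" for m
      using disjoint_gasket_corners that unfolding disjoint_family_on_def by blast
    then show ?thesis
      using corner_rotor_inwards(2)[OF assms(2) n] unfolding inwards_def by blast
  next
    case False
    then show ?thesis by (intro bexI[of _ 1]) auto
  qed
  then obtain g where g: "g c \<in> {1..4}" and g_inwards: "c \<in> gasket_corners n \<Longrightarrow> inwards n c (g c)"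
    for c n by metis
  have "AE \<omega> in M. infinite {n. \<forall>c\<in>gasket_corners n. \<rho> c \<omega> = g c}"
    using assms(3) g gasket_corners_subset finite_gasket_corners gasket_corners_nonempty
      card_gasket_corners disjoint_gasket_corners
    by (intro uniform_rotors_agree_infinitely_often[where N = 4])
  then show ?thesis
  proof eventually_elim
    fix \<omega> assume inf: "infinite {n. \<forall>c\<in>gasket_corners n. \<rho> c \<omega> = g c}"
    let ?\<rho> = "\<lambda>v. \<rho> v \<omega>"
    have exits: "exits (gasket_block n) \<subseteq> gasket_corners n" for n
      using gasket_block_exit unfolding exits_def by blast
    have "\<exists>B. barrier ?\<rho> B \<and> 0 \<in> B \<and> exits B \<inter> F = {}" if F: "finite F" for F
    proof -
      \<comment> \<open>the corner sets are told apart by their levels, so a finite set \<open>F\<close> meets only finitely many\<close>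
      define N where "N = {n. gasket_corners n \<inter> F \<noteq> {}}"
      have "finite N"
      proof (rule finite_subset)
        show "N \<subseteq> (\<lambda>n. 2 ^ n) -` (gasket_level ` F)"
          using gasket_level_corners unfolding N_def by (force simp: image_iff)
        show "finite ((\<lambda>n. 2 ^ n :: real) -` (gasket_level ` F))"
          using F by (intro finite_vimageI finite_imageI) (auto simp: inj_def)
      qed
      then obtain n where n: "\<forall>c\<in>gasket_corners n. \<rho> c \<omega> = g c" "gasket_corners n \<inter> F = {}"
        using inf finite_subset[of "{n. \<forall>c\<in>gasket_corners n. \<rho> c \<omega> = g c}" N]
        unfolding N_def by blast
      have "barrier ?\<rho> (gasket_block n)"
        unfolding barrier_def
      proof (intro conjI ballI)
        fix c assume "c \<in> exits (gasket_block n)"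
        then have c: "c \<in> gasket_corners n" using exits by blast
        show "card (SG_neighbours c \<inter> gasket_block n) \<le> 2"
          using assms(2) c by (rule corner_rotor_inwards(1))
        show "cyc c (\<rho> c \<omega> mod 4 + 1) \<in> gasket_block n"
          "cyc c ((\<rho> c \<omega> + 1) mod 4 + 1) \<in> gasket_block n"
          using g_inwards[OF c] n(1) c unfolding inwards_def by auto
      qed (rule finite_gasket_block)
      then show ?thesis using exits[of n] n(2) origin_in_gasket_block[of n] by blast
    qed
    moreover have "0 \<in> SG_vertices" using origin_in_gasket_block by (simp add: gasket_block_def)
    moreover have "(0, v) \<in> linked" if "v \<in> SG_vertices" for v
      using gasket_connected[OF that] by (simp add: linked_def)
    ultimately show "\<forall>x\<in>SG_vertices. infinite {t. rotor_walk cyc ?\<rho> 0 t = x}"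
      by (intro ballI recurrent_if_barriers)
  qed
qed

end
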